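(* Let $a$ be an indeterminate. As formal power series in $q$ with coefficients rational functions of $a$, $$\sum_{n=0}^\infty\sum_{r=0}^\infty\sum_{j=0}^\infty \frac{a^{3n+2r+2j}\,q^{3n^2+\frac92r^2+3j^2+6nj+6nr+6rj-\frac52 r-j}\,(a^3;q^3)_{2j+r}\,\big(1+(aq)^{2r+2j}\big)\,(1-a^3q^{6j+6r})}{2\,(q^3;q^3)_n\,(q^3;q^3)_r\,(q^3;q^3)_j\,(-a^3q^3;q^3)_j\,(a^3;q^3)_{n+2j+2r+1}}$$ $$=\frac{1}{(a^3q^3;q^3)_\infty}\sum_{r=0}^\infty \frac{a^{3r}q^{3r^2}\,(a^3;q^3)_r\,(-q^3;q^3)_{r-1}\,(1-a^3q^{6r})\,\big((aq)^r+(aq)^{-r}\big)}{(q^3;q^3)_r\,(-a^3q^3;q^3)_r\,(1-a^3)}.$$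
   Context: Notation: $(A;q)_0=1$, $(A;q)_n=(1-A)(1-Aq)\cdots(1-Aq^{n-1})$ for $n\ge 1$, and $(A;q)_\infty=\prod_{i=0}^\infty(1-Aq^i)$. For index $-1$ the standard convention $(A;q)_{-1}=1/(1-Aq^{-1})$ is used, so that $(-q^3;q^3)_{-1}=\tfrac12$. The paper treats its identities as formal power series identities, which also yield identities of analytic functions for $|q|<1$. *)

theory Defs
  imports
    "HOL-Analysis.Analysis"
    "HOL-Computational_Algebra.Fraction_Field"
    "HOL-Computational_Algebra.Polynomial"
    "HOL-Computational_Algebra.Formal_Power_Series"
begin

text \<open>
  The q-Pochhammer symbol \<open>(A; p)\<^sub>n\<close> in the ring of formal power series, with the usual
  extension \<open>(A; p)\<^sub>-\<^sub>m = 1 / ((1 - A p\<^sup>-\<^sup>1) \<cdots> (1 - A p\<^sup>-\<^sup>m))\<close> to negative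
  indices.  The quotient \<open>A / p ^ i\<close> is the one of formal power series, so a
  negative index is only meaningful when \<open>p ^ i\<close> divides \<open>A\<close> for \<open>1 \<le> i \<le> m\<close>.
\<close>

definition qpoch :: "'a::field fps \<Rightarrow> 'a fps \<Rightarrow> int \<Rightarrow> 'a fps" where
  "qpoch A p n =
     (if n \<ge> 0 then \<Prod>i<nat n. 1 - A * p ^ i
      else 1 / (\<Prod>i=1..nat (- n). 1 - A / p ^ i))"

text \<open>The infinite product is taken in the metric topology of \<^typ>\<open>'a fps\<close>,
  i.e. the \<open>X\<close>-adic one.\<close>

definition qpoch_inf :: "'a::field fps \<Rightarrow> 'a fps \<Rightarrow> 'a fps" where
  "qpoch_inf A p = (\<Prod>i. 1 - A * p ^ i)"

lemma qpoch_minus_one: "qpoch A p (-1) = 1 / (1 - A / p)"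
  by (simp add: qpoch_def)

lemma qpoch_minus_X3_minus_one:
  "qpoch (- (fps_X ^ 3)) (fps_X ^ 3) (-1) = (1 / 2 :: 'a::field_char_0 fps)"
proof -
  have "fps_shift 3 (- (fps_X ^ 3)) = (- 1 :: 'a fps)"
    by (rule fps_ext) (simp add: fps_X_power_nth)
  then show ?thesis
    by (simp add: qpoch_minus_one)
qed

text \<open>The indeterminate \<open>a\<close>, as a constant power series over the field \<open>k(a)\<close> of
  rational functions.\<close>

definition indet :: "'k::field poly fract fps" where
  "indet = fps_const (Fract [:0, 1:] 1)"

end

theory Submission
  imports Defs
begin

text \<open>
  Put \<open>p = q^3\<close>, \<open>A = a^3\<close> and \<open>x = a q\<close>, so that \<open>x^3 = A p\<close>. In these variables the summand of the
  triple series depends on \<open>n\<close> only through the factor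
  \<open>z^n p^(n^2) / ((p; p)_n (z p; p)_n)\<close> with \<open>z = A p^(2 N)\<close> and \<open>N = r + j\<close>. By the Durfee square
  identity of Cauchy (\<open>Durfee_sum\<close>) the sum over \<open>n\<close> is \<open>1 / (z p; p)_\<infinity>\<close>, and together with the
  prefactor \<open>1 / (A; p)_(2 N + 1)\<close> this is \<open>1 / (A; p)_\<infinity>\<close>, whatever \<open>N\<close> is.

  What remains is a double sum over \<open>r\<close> and \<open>j\<close> in which, for fixed \<open>N\<close>, everything is constant
  except \<open>p^(r choose 2) (A p^N; p)_j / ((p; p)_r (p; p)_j (- A p; p)_j)\<close>. The sum of these terms
  over \<open>r + j = N\<close> is a terminating \<open>2\<phi>1\<close>, and the q-Chu-Vandermonde formula gives it the value
  \<open>(-1; p)_N / ((p; p)_N (- A p; p)_N)\<close> (\<open>sum_over_antidiagonal\<close>). As \<open>(-1; p)_N = 2 (- p; p)_(N - 1)\<close>, the antidiagonal \<open>r + j = N\<close> yields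
  exactly the \<open>N\<close>-th summand of the single series, divided by \<open>(A p; p)_\<infinity>\<close>.

  Both summation formulas come from one division-free identity, \<open>q_Chu_Vandermonde\<close>, valid in every
  commutative ring: the second is an instance of it, the first a limit of instances. The rest of the work is analytic: in the X-adic topology the
  triple family is summable, because its terms vanish to order at least \<open>2 N + n^2\<close>, and a summable
  family may be summed in any grouping.
\<close>

unbundle no vec_syntax
unbundle fps_syntax

section \<open>Gaussian binomials and rising q-factorials\<close>

text \<open>
  Power series over a field do not form a field, so the finite identities are stated without
  quotients, in an arbitrary commutative ring. For this the Gaussian binomial is defined by its
  Pascal rule rather than as a quotient of q-factorials.
\<close>

fun qbinom :: "'a::comm_ring_1 \<Rightarrow> nat \<Rightarrow> nat \<Rightarrow> 'a" where
  "qbinom p n 0 = 1"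
| "qbinom p 0 (Suc k) = 0"
| "qbinom p (Suc n) (Suc k) = p ^ Suc k * qbinom p n (Suc k) + qbinom p n k"

definition qrise :: "'a::comm_ring_1 \<Rightarrow> 'a \<Rightarrow> nat \<Rightarrow> 'a" where
  "qrise A p n = (\<Prod>i<n. 1 - A * p ^ i)"

lemma qpoch_int: "qpoch A p (int n) = qrise A p n"
  by (simp add: qpoch_def qrise_def)

lemma qrise_0 [simp]: "qrise A p 0 = 1"
  by (simp add: qrise_def)

lemma qrise_Suc: "qrise A p (Suc n) = qrise A p n * (1 - A * p ^ n)"
  by (simp add: qrise_def)

lemma qrise_add: "qrise A p (m + n) = qrise A p m * qrise (A * p ^ m) p n"
  by (induction n) (simp_all add: qrise_Suc power_add mult_ac)

lemma qbinom_eq_0: "n < k \<Longrightarrow> qbinom p n k = 0"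
proof (induction n arbitrary: k)
  case 0
  then show ?case by (cases k) auto
next
  case (Suc n)
  then show ?case by (cases k) auto
qed

lemma qbinom_self: "qbinom p n n = 1"
  by (induction n) (simp_all add: qbinom_eq_0)

lemma qbinom_mult_qrise:
  "qbinom p (m + k) k * qrise p p k * qrise p p m = qrise p p (m + k)"
proof (induction "m + k" arbitrary: m k)
  case 0
  then show ?case by simp
next
  case (Suc n)
  show ?case
  proof (cases k)
    case 0
    then show ?thesis by simp
  next
    case k: (Suc k')
    show ?thesis
    proof (cases m)
      case 0
      then show ?thesis by (simp add: qbinom_self)
    next
      case m: (Suc m')
      have n: "n = m' + k" "n = m + k'"
        using Suc(2) k m by auto
      define R where "R = qrise p p n"
      have 1: "qbinom p n k * qrise p p k * qrise p p m' = R"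
        using Suc(1)[of m' k] n unfolding R_def by metis
      have 2: "qbinom p n k' * qrise p p k' * qrise p p m = R"
        using Suc(1)[of m k'] n unfolding R_def by metis
      have k_step: "qrise p p k = qrise p p k' * (1 - p * p ^ k')"
        and m_step: "qrise p p m = qrise p p m' * (1 - p * p ^ m')"
        by (simp_all add: k m qrise_Suc)
      have "qbinom p (m + k) k = p ^ k * qbinom p n k + qbinom p n k'"
        unfolding Suc(2)[symmetric] by (simp add: k)
      then have "qbinom p (m + k) k * qrise p p k * qrise p p m
          = p ^ k * qbinom p n k * qrise p p k * qrise p p m
            + qbinom p n k' * qrise p p k * qrise p p m"
        by (simp add: distrib_right)
      also have "p ^ k * qbinom p n k * qrise p p k * qrise p p m
          = p ^ k * (1 - p * p ^ m') * (qbinom p n k * qrise p p k * qrise p p m')"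
        unfolding m_step by (simp only: mult_ac)
      also have "qbinom p n k' * qrise p p k * qrise p p m
          = (1 - p * p ^ k') * (qbinom p n k' * qrise p p k' * qrise p p m)"
        unfolding k_step by (simp only: mult_ac)
      also have "p ^ k * (1 - p * p ^ m') * (qbinom p n k * qrise p p k * qrise p p m') + \<dots>
          = R * (1 - p * p ^ n)"
        unfolding 1 2 unfolding n(2) by (simp add: k m power_add algebra_simps)
      also have "\<dots> = qrise p p (m + k)"
        unfolding Suc(2)[symmetric] R_def by (simp add: qrise_Suc)
      finally show ?thesis .
    qed
  qed
qed

section \<open>The q-Chu-Vandermonde sum, homogenised\<close>

text \<open>
  In the usual form, the terminating \<open>2\<phi>1\<close> with parameters \<open>p^(-N)\<close> and \<open>w/u\<close> over \<open>w/s\<close> has the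
  sum \<open>(u/s; p)_N / (w/s; p)_N\<close>. Clearing denominators turns \<open>s\<close>, \<open>u\<close>, \<open>w\<close> into independent elements
  of a ring, so that degenerate values such as \<open>u = 0\<close> are allowed. The induction keeps \<open>s\<close> and replaces
  \<open>(u, w)\<close> by \<open>(u p, w p)\<close>. The two halves of the Pascal rule then contribute the \<open>j\<close>-th summand for
  \<open>N\<close> with the factors \<open>s - w p^j\<close> and \<open>w p^j - u\<close>, whose sum \<open>s - u\<close> no longer depends on \<open>j\<close>.
\<close>

lemma q_Chu_Vandermonde:
  fixes p s u w :: "'a::comm_ring_1"
  shows "(\<Sum>j\<le>N. qbinom p N j * p ^ (j choose 2) * (\<Prod>i<j. w * p ^ i - u)
            * (\<Prod>i<N - j. s - w * p ^ (j + i)))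
         = (\<Prod>i<N. s - u * p ^ i)"
proof (induction N arbitrary: u w)
  case 0
  then show ?case by (simp add: numeral_2_eq_2)
next
  case (Suc N)
  define T where "T = (\<lambda>M j. p ^ (j choose 2) * (\<Prod>i<j. w * p ^ i - u)
            * (\<Prod>i<M - j. s - w * p ^ (j + i)))"
  \<comment> \<open>the summand of the induction hypothesis for \<open>(u p, w p)\<close>\<close>
  define S where "S = (\<lambda>j. p ^ (j choose 2) * (\<Prod>i<j. w * p * p ^ i - u * p)
            * (\<Prod>i<N - j. s - w * p * p ^ (j + i)))"
  have e: "(\<Prod>i<j. w * p * p ^ i - u * p) = p ^ j * (\<Prod>i<j. w * p ^ i - u)" for j
  proof -
    have "(\<Prod>i<j. w * p * p ^ i - u * p) = (\<Prod>i<j. p * (w * p ^ i - u))"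
      by (simp add: algebra_simps)
    then show ?thesis
      by (simp add: prod.distrib)
  qed
  have a: "p ^ j * T (Suc N) j = S j * (s - w * p ^ j)" if "j \<le> N" for j
  proof -
    have "Suc N - j = Suc (N - j)"
      using that by simp
    then have "(\<Prod>i<Suc N - j. s - w * p ^ (j + i))
        = (s - w * p ^ j) * (\<Prod>i<N - j. s - w * p * p ^ (j + i))"
      by (simp add: prod.lessThan_Suc_shift algebra_simps del: prod.lessThan_Suc)
    with e[of j] show ?thesis
      unfolding T_def S_def by (simp add: mult_ac)
  qed
  have b: "T (Suc N) (Suc j) = S j * (w * p ^ j - u)" if "j \<le> N" for j
  proof -
    have c: "Suc j choose 2 = j + (j choose 2)"
      by (simp add: numeral_2_eq_2)
    have "(\<Prod>i<N - j. s - w * p ^ (Suc j + i)) = (\<Prod>i<N - j. s - w * p * p ^ (j + i))"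
      by (simp add: mult_ac)
    with e[of j] show ?thesis
      unfolding T_def S_def by (simp add: c power_add mult_ac)
  qed
  have "(\<Sum>j\<le>Suc N. qbinom p (Suc N) j * T (Suc N) j)
      = (\<Sum>j\<le>Suc N. qbinom p N j * (p ^ j * T (Suc N) j))
        + (\<Sum>j\<le>N. qbinom p N j * T (Suc N) (Suc j))"
    unfolding sum.atMost_Suc_shift
    by (simp add: sum.distrib algebra_simps)
  also have "(\<Sum>j\<le>Suc N. qbinom p N j * (p ^ j * T (Suc N) j))
      = (\<Sum>j\<le>N. qbinom p N j * (S j * (s - w * p ^ j)))"
    by (simp add: qbinom_eq_0 a)
  also have "(\<Sum>j\<le>N. qbinom p N j * T (Suc N) (Suc j))
      = (\<Sum>j\<le>N. qbinom p N j * (S j * (w * p ^ j - u)))"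
    by (simp add: b)
  also have "(\<Sum>j\<le>N. qbinom p N j * (S j * (s - w * p ^ j))) + \<dots>
      = (s - u) * (\<Sum>j\<le>N. qbinom p N j * S j)"
    by (simp add: sum.distrib[symmetric] sum_distrib_left algebra_simps)
  also have "(\<Sum>j\<le>N. qbinom p N j * S j) = (\<Prod>i<N. s - u * p * p ^ i)"
    using Suc[of "w * p" "u * p"] unfolding S_def by (simp add: mult.assoc)
  also have "(s - u) * \<dots> = (\<Prod>i<Suc N. s - u * p ^ i)"
    by (simp add: prod.lessThan_Suc_shift mult_ac del: prod.lessThan_Suc)
  finally show ?case
    unfolding T_def by (simp only: mult.assoc)
qed

lemma prod_power_lessThan: "(\<Prod>i<n. p ^ i) = p ^ (n choose 2)"
  for p :: "'a::comm_monoid_mult"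
proof (induction n)
  case (Suc n)
  have "Suc n choose 2 = n + (n choose 2)"
    by (simp add: numeral_2_eq_2)
  with Suc show ?case by (simp add: power_add mult_ac)
qed (simp add: numeral_2_eq_2)

lemma two_choose_two: "2 * (n choose 2) + n = n ^ 2"
proof (induction n)
  case (Suc n)
  have "Suc n choose 2 = n + (n choose 2)"
    by (simp add: numeral_2_eq_2)
  with Suc show ?case by (simp add: power2_eq_square)
qed (simp add: numeral_2_eq_2)

text \<open>
  The case \<open>s = 1\<close>, \<open>u = 0\<close>, \<open>w = z p\<close>, in which the factors \<open>w p^i - u\<close> collapse to a monomial.
  Divided by \<open>qrise (z p) p M\<close>, it counts the partitions into parts of size at most \<open>M\<close>, with \<open>z\<close>
  marking the number of parts, by the side \<open>n\<close> of their Durfee square.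
\<close>

lemma finite_Durfee_sum:
  fixes p z :: "'a::comm_ring_1"
  shows "(\<Sum>n\<le>M. qbinom p M n * z ^ n * p ^ n\<^sup>2 * qrise (z * p * p ^ n) p (M - n)) = 1"
proof -
  have "z ^ n * p ^ n\<^sup>2 = p ^ (n choose 2) * (\<Prod>i<n. z * p * p ^ i)" for n
    unfolding two_choose_two[symmetric]
    by (simp add: prod.distrib prod_power_lessThan power_add mult_2 power_mult_distrib mult_ac)
  then have "qbinom p M n * z ^ n * p ^ n\<^sup>2 * qrise (z * p * p ^ n) p (M - n)
      = qbinom p M n * p ^ (n choose 2) * (\<Prod>i<n. z * p * p ^ i - 0)
        * (\<Prod>i<M - n. 1 - z * p * p ^ (n + i))" for n
    by (simp add: qrise_def power_add mult.assoc)
  then show ?thesis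
    using q_Chu_Vandermonde[of p M "z * p" 0 1] by simp
qed

text \<open>
  The parameters \<open>A p^N\<close> over \<open>- A p\<close>, whose quotient \<open>- p^(1 - N)\<close> is a negative power of \<open>p\<close>. In the
  homogenised identity this is \<open>s = p^(N - 1)\<close>, \<open>u = -1\<close>, \<open>w = - A p^N\<close>; both sides then carry the extra
  factor \<open>p^(N choose 2)\<close>, which can be cancelled in a domain.
\<close>

lemma q_Chu_Vandermonde_minus:
  fixes p A :: "'a::idom"
  assumes "p \<noteq> 0"
  shows "(\<Sum>j\<le>N. qbinom p N j * p ^ ((N - j) choose 2) * qrise (A * p ^ N) p j
            * qrise (- (A * p) * p ^ j) p (N - j)) = (\<Prod>i<N. 1 + p ^ i)"
    (is "?S = _")
proof (cases N)
  case 0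
  then show ?thesis by (simp add: numeral_2_eq_2)
next
  case (Suc L)
  have t: "p ^ (N choose 2) * (qbinom p N j * p ^ ((N - j) choose 2) * qrise (A * p ^ N) p j
            * qrise (- (A * p) * p ^ j) p (N - j))
        = qbinom p N j * p ^ (j choose 2) * (\<Prod>i<j. - (A * p ^ N) * p ^ i - (- 1))
            * (\<Prod>i<N - j. p ^ L - (- (A * p ^ N)) * p ^ (j + i))" if "j \<le> N" for j
  proof -
    define m where "m = N - j"
    with that have m: "N = j + m"
      by simp
    have "(\<Prod>i<m. p ^ L - (- (A * p ^ N)) * p ^ (j + i))
        = (\<Prod>i<m. p ^ L * (1 - (- (A * p) * p ^ j) * p ^ i))"
      by (simp add: Suc power_add algebra_simps)
    also have "\<dots> = p ^ (L * m) * qrise (- (A * p) * p ^ j) p m"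
      by (simp add: prod.distrib qrise_def power_mult)
    finally have 1: "(\<Prod>i<m. p ^ L - (- (A * p ^ N)) * p ^ (j + i)) = \<dots>" .
    have 2: "(\<Prod>i<j. - (A * p ^ N) * p ^ i - (- 1)) = qrise (A * p ^ N) p j"
      by (simp add: qrise_def)
    \<comment> \<open>the power of \<open>p\<close> taken out of the factors with \<open>s = p^L\<close> accounts for the change of exponent\<close>
    have "N * N + m * m = j * j + 2 * (N * m)"
      unfolding m by (simp add: algebra_simps)
    moreover have "N * m = L * m + m"
      by (simp add: Suc)
    moreover note m two_choose_two[of N] two_choose_two[of m] two_choose_two[of j]
    ultimately have 3: "(N choose 2) + (m choose 2) = (j choose 2) + L * m"
      unfolding power2_eq_square by linarith
    have 4: "N - j = m" using m by simp
    have "p ^ (N choose 2) * (qbinom p N j * p ^ (m choose 2) * qrise (A * p ^ N) p j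
            * qrise (- (A * p) * p ^ j) p m)
        = (p ^ (N choose 2) * p ^ (m choose 2)) * (qbinom p N j * qrise (A * p ^ N) p j
            * qrise (- (A * p) * p ^ j) p m)"
      by (simp only: mult_ac)
    also have "\<dots> = (p ^ (j choose 2) * p ^ (L * m)) * (qbinom p N j * qrise (A * p ^ N) p j
            * qrise (- (A * p) * p ^ j) p m)"
      using 3 by (simp only: power_add[symmetric])
    finally show ?thesis
      unfolding 4 1 2 by (simp only: mult_ac)
  qed
  have "p ^ (N choose 2) * ?S = (\<Prod>i<N. p ^ L - (- 1) * p ^ i)"
    unfolding q_Chu_Vandermonde[of p N "- (A * p ^ N)" "- 1" "p ^ L", symmetric] sum_distrib_left
    by (rule sum.cong[OF refl], rule t) simp
  \<comment> \<open>the factor with index \<open>i\<close> becomes the one with index \<open>L - i\<close> of the claim\<close>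
  also have "\<dots> = (\<Prod>i<N. p ^ i * (1 + p ^ (L - i)))"
    by (intro prod.cong refl) (simp add: Suc distrib_left power_add[symmetric])
  also have "\<dots> = p ^ (N choose 2) * (\<Prod>i<N. 1 + p ^ (N - Suc i))"
    by (simp add: prod.distrib prod_power_lessThan Suc del: prod.lessThan_Suc)
  also have "(\<Prod>i<N. 1 + p ^ (N - Suc i)) = (\<Prod>i<N. 1 + p ^ i)"
    by (rule prod.nat_diff_reindex)
  finally show ?thesis
    using assms by simp
qed

section \<open>Sums and products in the X-adic topology\<close>

lemma tendsto_mult_fps:
  fixes f g :: "'b \<Rightarrow> 'a::comm_ring_1 fps"
  assumes "(f \<longlongrightarrow> a) F" and "(g \<longlongrightarrow> b) F"
  shows "((\<lambda>x. f x * g x) \<longlongrightarrow> a * b) F"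
proof (rule tendsto_fpsI)
  fix n
  have "\<forall>\<^sub>F x in F. \<forall>k\<in>{..n}. f x $ k = a $ k"
    using assms(1) by (subst eventually_ball_finite_distrib) (auto simp: tendsto_fps_iff)
  moreover have "\<forall>\<^sub>F x in F. \<forall>k\<in>{..n}. g x $ k = b $ k"
    using assms(2) by (subst eventually_ball_finite_distrib) (auto simp: tendsto_fps_iff)
  ultimately show "\<forall>\<^sub>F x in F. (f x * g x) $ n = (a * b) $ n"
    by eventually_elim (auto simp: fps_mult_nth intro!: sum.cong)
qed

lemma has_sum_mult_left_fps:
  fixes f :: "'b \<Rightarrow> 'a::comm_ring_1 fps"
  assumes "(f has_sum S) I"
  shows "((\<lambda>x. c * f x) has_sum c * S) I"
  using tendsto_mult_fps[OF tendsto_const[of c] assms[unfolded has_sum_def]]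
  by (simp add: has_sum_def sum_distrib_left)

text \<open>
  The metric is translation invariant. Uniform continuity of addition is what allows an unconditional
  sum to be grouped.
\<close>

lemma uniformly_continuous_add_fps:
  "uniformly_continuous_on UNIV (\<lambda>(x::'a::ab_group_add fps, y). x + y)"
  unfolding uniformly_continuous_on_def
proof (intro allI impI)
  fix e :: real
  assume "e > 0"
  have trans: "dist (x + z) (y + z) = dist x y" for x y z :: "'a fps"
    by (simp add: dist_fps_def)
  have "dist (case z' of (x, y) \<Rightarrow> x + y) (case z of (x, y) \<Rightarrow> x + y) < e"
    if "dist z' z < e / 2" for z z' :: "'a fps \<times> 'a fps"
  proof -
    obtain x y x' y' where z: "z = (x, y)" "z' = (x', y')"
      by (cases z, cases z')
    have "dist (x' + y') (x + y) \<le> dist (x' + y') (x + y') + dist (y' + x) (y + x)"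
      by (metis add.commute dist_triangle)
    also have "\<dots> = dist x' x + dist y' y"
      by (simp only: trans)
    also have "\<dots> < e"
      using dist_fst_le[of z' z] dist_snd_le[of z' z] that by (simp add: z)
    finally show ?thesis by (simp add: z)
  qed
  with \<open>e > 0\<close> show "\<exists>d>0. \<forall>x\<in>UNIV. \<forall>x'\<in>UNIV. dist x' x < d \<longrightarrow>
      dist (case x' of (x, y) \<Rightarrow> x + y) (case x of (x, y) \<Rightarrow> x + (y :: 'a fps)) < e"
    by (intro exI[of _ "e / 2"]) auto
qed

lemma summable_on_fpsI:
  fixes f :: "'b \<Rightarrow> 'a::comm_ring_1 fps"
  assumes "\<And>x. x \<in> I \<Longrightarrow> fps_X ^ e x dvd f x"
    and "\<And>k. finite {x \<in> I. e x \<le> k}"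
  shows "f summable_on I"
proof -
  have zero: "f x $ k = 0" if "x \<in> I" "k < e x" for x k
    using assms(1)[OF that(1)] that(2) by (auto simp: fps_X_power_mult_nth elim!: dvdE)
  define S where "S = Abs_fps (\<lambda>k. \<Sum>x | x \<in> I \<and> f x $ k \<noteq> 0. f x $ k)"
  have "finite {x \<in> I. f x $ k \<noteq> 0}" for k
    by (rule finite_subset[OF _ assms(2)[of k]]) (use zero not_le in blast)
  then have "(f has_sum S) I"
    by (rule has_sum_fpsI) (simp add: S_def)
  then show ?thesis
    by (auto simp: summable_on_def)
qed

text \<open>
  Factors congruent to 1 modulo \<open>d\<close> have a product congruent to 1 modulo \<open>d\<close>. For \<open>d = p^k\<close> this
  bounds the error of every truncation below.
\<close>

lemma dvd_one_minus_prod: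
  fixes d :: "'a::comm_ring_1"
  assumes "\<And>i. i \<in> I \<Longrightarrow> d dvd 1 - f i"
  shows "d dvd 1 - prod f I"
  using assms
proof (induction I rule: infinite_finite_induct)
  case (insert x I)
  have "1 - prod f (insert x I) = (1 - f x) + f x * (1 - prod f I)"
    using insert by (simp add: algebra_simps)
  with insert show ?case
    by (metis dvd_add dvd_mult insertI1 insert_iff)
qed auto

lemma dvd_one_minus_qrise:
  "p ^ k dvd A \<Longrightarrow> p ^ k dvd 1 - qrise A p n"
  unfolding qrise_def by (rule dvd_one_minus_prod) simp

lemma fps_X_power_dvd_imp_nth_eq:
  fixes f g :: "'a::comm_ring_1 fps"
  assumes "fps_X ^ k dvd f - g" "n < k"
  shows "f $ n = g $ n"
proof -
  obtain h where "f - g = fps_X ^ k * h"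
    using assms(1) by (auto elim: dvdE)
  with assms(2) have "(f - g) $ n = 0"
    by (simp only: fps_X_power_mult_nth if_True)
  then show ?thesis by simp
qed

lemma fps_X_dvd_iff: "fps_X dvd f \<longleftrightarrow> f $ 0 = 0"
  for f :: "'a::comm_ring_1 fps"
proof
  assume "f $ 0 = 0"
  then have "f = fps_X * fps_shift 1 f"
    by (intro fps_ext) (auto simp: fps_X_mult_nth)
  then show "fps_X dvd f" by (metis dvd_triv_left)
qed (auto elim!: dvdE)

section \<open>Summation of the triple series\<close>

lemma fps_X_power_dvd_power: "f $ 0 = 0 \<Longrightarrow> fps_X ^ k dvd f ^ k"
  for f :: "'a::comm_ring_1 fps"
  by (intro dvd_power_same) (simp add: fps_X_dvd_iff)

lemma qrise_nth_0 [simp]: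
  fixes A p :: "'a::comm_ring_1 fps"
  assumes "A $ 0 = 0"
  shows "qrise A p n $ 0 = 1"
  using assms by (induction n) (simp_all add: qrise_Suc)

text \<open>
  The factors from index \<open>k + 1\<close> on are congruent to 1 modulo \<open>p^(k + 1)\<close>, so the coefficient of
  \<open>X^k\<close> is the same in all partial products with more than \<open>k\<close> factors.
\<close>

lemma qrise_tendsto_qpoch_inf:
  fixes A p :: "'a::field fps"
  assumes "A $ 0 = 0" "p $ 0 = 0"
  shows "convergent_prod (\<lambda>i. 1 - A * p ^ i)" (is ?C)
    and "(\<lambda>n. qrise A p n) \<longlonglongrightarrow> qpoch_inf A p" (is ?L)
    and "qpoch_inf A p $ 0 = 1" (is ?Z)
proof -
  have X: "fps_X ^ k dvd p ^ k" for k
    using assms(2) by (rule fps_X_power_dvd_power)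
  have stable: "qrise A p n $ k = qrise A p (Suc k) $ k" if "Suc k \<le> n" for n k
  proof -
    define m where "m = n - Suc k"
    have n: "n = Suc k + m"
      unfolding m_def using that by simp
    have "fps_X ^ Suc k dvd p ^ Suc k" by (rule X)
    also have "p ^ Suc k dvd 1 - qrise (A * p ^ Suc k) p m"
      by (intro dvd_one_minus_qrise) simp
    also have "\<dots> dvd qrise A p (Suc k) * (1 - qrise (A * p ^ Suc k) p m)"
      by (rule dvd_triv_right)
    also have "\<dots> = qrise A p (Suc k) - qrise A p n"
      unfolding n qrise_add right_diff_distrib by (simp only: mult_1_right)
    finally have "fps_X ^ Suc k dvd qrise A p (Suc k) - qrise A p n" .
    then show ?thesis
      by (rule fps_X_power_dvd_imp_nth_eq[symmetric]) simp
  qed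
  define Q where "Q = Abs_fps (\<lambda>k. qrise A p (Suc k) $ k)"
  have lim: "(\<lambda>n. qrise A p n) \<longlonglongrightarrow> Q"
  proof (rule tendsto_fpsI)
    fix k
    show "\<forall>\<^sub>F n in sequentially. qrise A p n $ k = Q $ k"
      using eventually_ge_at_top[of "Suc k"]
    proof eventually_elim
      case (elim n)
      then show ?case
        using stable[of k n] by (simp add: Q_def)
    qed
  qed
  have Q0: "Q $ 0 = 1"
    using assms by (simp add: Q_def)
  have "(\<lambda>n. \<Prod>i\<le>n. 1 - A * p ^ i) \<longlonglongrightarrow> Q"
    using LIMSEQ_Suc[OF lim] by (simp add: qrise_def lessThan_Suc_atMost)
  moreover have "Q \<noteq> 0"
    using Q0 by force
  ultimately have rp: "raw_has_prod (\<lambda>i. 1 - A * p ^ i) 0 Q"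
    by (simp add: raw_has_prod_def)
  then have hp: "(\<lambda>i. 1 - A * p ^ i) has_prod Q"
    by (simp add: has_prod_def)
  then have "qpoch_inf A p = Q"
    unfolding qpoch_inf_def by (rule has_prod_unique[symmetric])
  with lim Q0 show ?L ?Z by simp_all
  show ?C
    unfolding convergent_prod_def using rp by blast
qed

section \<open>The Durfee square identity\<close>

text \<open>
  Hence the product \<open>qbinom p M n * qrise p p n\<close> is congruent to 1 modulo \<open>p^(M - n + 1)\<close>.
\<close>

lemma qbinom_mult_qrise_eq:
  fixes p :: "'a::idom"
  assumes "n \<le> M" "qrise p p (M - n) \<noteq> 0"
  shows "qbinom p M n * qrise p p n = qrise (p * p ^ (M - n)) p n"
proof -
  have "qbinom p M n * qrise p p n * qrise p p (M - n) = qrise p p ((M - n) + n)"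
    using qbinom_mult_qrise[of p "M - n" n] assms(1) by simp
  also have "\<dots> = qrise (p * p ^ (M - n)) p n * qrise p p (M - n)"
    unfolding qrise_add by (simp only: mult_ac)
  finally show ?thesis
    using assms(2) by simp
qed

text \<open>
  Cauchy's identity, as the limit \<open>M \<rightarrow> \<infinity>\<close> of the finite Durfee sum divided by \<open>qrise (z p) p M\<close>.
  The \<open>n\<close>-th summand of the finite sum differs from that of the series by the factor
  \<open>qbinom p M n * qrise p p n\<close>, an error divisible by \<open>p^(n^2 + M - n + 1)\<close> and so by \<open>p^(M + 1)\<close>.
  The \<open>M\<close>-th partial sum of the series therefore agrees with \<open>1 / qrise (z p) p M\<close> up to \<open>X^M\<close>.
\<close>

lemma Durfee_sum:
  fixes p z :: "'a::field fps"
  assumes p: "p $ 0 = 0"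
  shows "((\<lambda>n. z ^ n * p ^ n\<^sup>2 * inverse (qrise p p n * qrise (z * p) p n))
           has_sum inverse (qpoch_inf (z * p) p)) UNIV"
proof -
  define t where "t = (\<lambda>n. z ^ n * p ^ n\<^sup>2 * inverse (qrise p p n * qrise (z * p) p n))"
  have Xp: "fps_X ^ k dvd p ^ k" for k
    using p by (rule fps_X_power_dvd_power)
  have zp: "(z * p) $ 0 = 0"
    using p by simp
  have "t summable_on UNIV"
  proof (rule summable_on_fpsI)
    show "fps_X ^ n\<^sup>2 dvd t n" for n
      unfolding t_def using Xp by (intro dvd_mult2 dvd_mult)
    show "finite {n \<in> UNIV. n\<^sup>2 \<le> k}" for k :: nat
      by (rule finite_subset[of _ "{..k}"]) (use power2_nat_le_imp_le in auto)
  qed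
  then have t_sum: "(t has_sum infsum t UNIV) UNIV"
    by (rule has_sum_infsum)
  have partial: "(\<Sum>n\<le>M. t n) $ k = inverse (qrise (z * p) p M) $ k" if "k \<le> M" for M k
  proof -
    \<comment> \<open>\<open>t n\<close> is \<open>p^(n^2) h n\<close>; the finite sum has the additional factor \<open>qbinom p M n * qrise p p n\<close>\<close>
    define h where "h = (\<lambda>n. z ^ n * inverse (qrise p p n * qrise (z * p) p n))"
    have "inverse (qrise (z * p) p M)
        = (\<Sum>n\<le>M. qbinom p M n * z ^ n * p ^ n\<^sup>2
            * (qrise (z * p * p ^ n) p (M - n) * inverse (qrise (z * p) p M)))"
      using arg_cong[OF finite_Durfee_sum[of p M z], of "\<lambda>x. x * inverse (qrise (z * p) p M)"]
      by (simp add: sum_distrib_right mult.assoc)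
    also have "\<dots> = (\<Sum>n\<le>M. p ^ n\<^sup>2 * (qbinom p M n * qrise p p n) * h n)"
    proof (rule sum.cong[OF refl])
      fix n assume "n \<in> {..M}"
      then have "qrise (z * p) p M = qrise (z * p) p n * qrise (z * p * p ^ n) p (M - n)"
        by (simp flip: qrise_add)
      then have "qrise (z * p * p ^ n) p (M - n) * inverse (qrise (z * p) p M)
          = (qrise p p n * inverse (qrise p p n)) * inverse (qrise (z * p) p n)
            * (qrise (z * p * p ^ n) p (M - n) * inverse (qrise (z * p * p ^ n) p (M - n)))"
        using p by (simp add: fps_inverse_mult inverse_mult_eq_1')
      also have "\<dots> = qrise p p n * inverse (qrise p p n * qrise (z * p) p n)"
        using p by (simp add: fps_inverse_mult inverse_mult_eq_1')
      finally show "qbinom p M n * z ^ n * p ^ n\<^sup>2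
            * (qrise (z * p * p ^ n) p (M - n) * inverse (qrise (z * p) p M))
          = p ^ n\<^sup>2 * (qbinom p M n * qrise p p n) * h n"
        unfolding h_def by (simp only: mult_ac)
    qed
    finally have inv: "inverse (qrise (z * p) p M)
        = (\<Sum>n\<le>M. p ^ n\<^sup>2 * (qbinom p M n * qrise p p n) * h n)" .
    have "fps_X ^ Suc M dvd (\<Sum>n\<le>M. t n) - inverse (qrise (z * p) p M)"
      unfolding inv sum_subtractf[symmetric]
    proof (rule dvd_sum)
      fix n assume n: "n \<in> {..M}"
      have nz: "qrise p p (M - n) \<noteq> 0"
        using p by (metis qrise_nth_0 fps_zero_nth zero_neq_one)
      have "n \<le> n\<^sup>2"
        by (simp add: power2_eq_square)
      with n have "Suc M \<le> n\<^sup>2 + Suc (M - n)"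
        by simp
      then have "(fps_X :: 'a fps) ^ Suc M dvd fps_X ^ (n\<^sup>2 + Suc (M - n))"
        by (rule le_imp_power_dvd)
      also have "\<dots> dvd p ^ (n\<^sup>2 + Suc (M - n))"
        by (rule Xp)
      also have "\<dots> = p ^ n\<^sup>2 * p ^ Suc (M - n)"
        by (rule power_add)
      also have "p ^ Suc (M - n) dvd 1 - qbinom p M n * qrise p p n"
        using n nz qbinom_mult_qrise_eq[of n M p] dvd_one_minus_qrise[of p "Suc (M - n)"] by simp
      then have "p ^ n\<^sup>2 * p ^ Suc (M - n) dvd p ^ n\<^sup>2 * (1 - qbinom p M n * qrise p p n)"
        by (rule mult_dvd_mono[OF dvd_refl])
      also have "\<dots> dvd t n - p ^ n\<^sup>2 * (qbinom p M n * qrise p p n) * h n"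
        by (rule dvdI[of _ _ "h n"]) (simp add: t_def h_def algebra_simps)
      finally show "fps_X ^ Suc M dvd t n - p ^ n\<^sup>2 * (qbinom p M n * qrise p p n) * h n" .
    qed
    then show ?thesis
      by (rule fps_X_power_dvd_imp_nth_eq) (use that in simp)
  qed
  have "(\<lambda>M. \<Sum>n\<le>M. t n) \<longlonglongrightarrow> infsum t UNIV"
    using has_sum_imp_sums[OF t_sum] by (simp add: sums_def_le)
  moreover have "(\<lambda>M. inverse (qrise (z * p) p M)) \<longlonglongrightarrow> inverse (qpoch_inf (z * p) p)"
    using qrise_tendsto_qpoch_inf(2,3)[OF zp p] by (intro tendsto_inverse_fps) auto
  then have "(\<lambda>M. \<Sum>n\<le>M. t n) \<longlonglongrightarrow> inverse (qpoch_inf (z * p) p)"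
    unfolding tendsto_fps_iff
  proof (rule all_forward)
    fix k
    assume "\<forall>\<^sub>F M in sequentially.
      inverse (qrise (z * p) p M) $ k = inverse (qpoch_inf (z * p) p) $ k"
    then show "\<forall>\<^sub>F M in sequentially. (\<Sum>n\<le>M. t n) $ k = inverse (qpoch_inf (z * p) p) $ k"
      using eventually_ge_at_top[of k] by eventually_elim (simp add: partial)
  qed
  ultimately have "infsum t UNIV = inverse (qpoch_inf (z * p) p)"
    using LIMSEQ_unique by blast
  with t_sum show ?thesis
    by (simp add: t_def)
qed

text \<open>
  Both sides are the product of the factors \<open>1 - A p^i\<close> over all \<open>i\<close>, broken off after \<open>m + 1\<close> factors and after one.
\<close>

lemma qpoch_inf_split:
  fixes A p :: "'a::field fps"
  assumes "p $ 0 = 0"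
  shows "qrise A p (Suc m) * qpoch_inf (A * p ^ m * p) p = (1 - A) * qpoch_inf (A * p) p"
proof -
  have lim: "(\<lambda>n. qrise (A * p) p n) \<longlonglongrightarrow> qpoch_inf (A * p) p"
    "(\<lambda>n. qrise (A * p ^ m * p) p n) \<longlonglongrightarrow> qpoch_inf (A * p ^ m * p) p"
    using assms by (simp_all add: qrise_tendsto_qpoch_inf)
  have "qrise A p (Suc m) * qrise (A * p ^ m * p) p n = (1 - A) * qrise (A * p) p (n + m)" for n
  proof -
    have "qrise A p (Suc m) * qrise (A * p ^ m * p) p n = qrise A p (1 + (n + m))"
      using qrise_add[of A p "Suc m" n] by (simp add: add.commute mult_ac)
    also have "\<dots> = (1 - A) * qrise (A * p) p (n + m)"
      unfolding qrise_add[of A p 1] by (simp add: qrise_def)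
    finally show ?thesis .
  qed
  then have "(\<lambda>n. (1 - A) * qrise (A * p) p (n + m))
      \<longlonglongrightarrow> qrise A p (Suc m) * qpoch_inf (A * p ^ m * p) p"
    using tendsto_mult_fps[OF tendsto_const lim(2)] by (metis (no_types, lifting) ext)
  moreover have "(\<lambda>n. (1 - A) * qrise (A * p) p (n + m)) \<longlonglongrightarrow> (1 - A) * qpoch_inf (A * p) p"
    by (rule tendsto_mult_fps[OF tendsto_const LIMSEQ_ignore_initial_segment[OF lim(1)]])
  ultimately show ?thesis
    by (rule LIMSEQ_unique)
qed

section \<open>The sum over an antidiagonal\<close>

lemma fps_inverse_eqI:
  fixes f g h :: "'a::field fps"
  assumes "f * g = h" "h $ 0 \<noteq> 0"
  shows "inverse f = g * inverse h"
proof -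
  have "h $ 0 = f $ 0 * g $ 0"
    unfolding assms(1)[symmetric] by simp
  with assms(2) have "g $ 0 \<noteq> 0"
    by simp
  then show ?thesis
    unfolding assms(1)[symmetric] fps_inverse_mult by (simp add: inverse_mult_eq_1')
qed

text \<open>
  Over the common denominator \<open>qrise p p N * qrise (- A p) p N\<close>, the summands on the left become
  those of \<open>q_Chu_Vandermonde_minus\<close> times the common factor \<open>qrise A p N\<close>.
\<close>

lemma sum_over_antidiagonal:
  fixes A p :: "'a::field fps"
  assumes p: "p $ 0 = 0" "p \<noteq> 0"
  shows "(\<Sum>j\<le>N. p ^ ((N - j) choose 2) * qrise A p (N + j)
            * inverse (qrise p p (N - j) * qrise p p j * qrise (- (A * p)) p j))
         = qrise A p N * (\<Prod>i<N. 1 + p ^ i) * inverse (qrise p p N * qrise (- (A * p)) p N)"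
    (is "_ = ?R")
proof -
  define D where "D = qrise A p N * inverse (qrise p p N * qrise (- (A * p)) p N)"
  have summand: "p ^ ((N - j) choose 2) * qrise A p (N + j)
            * inverse (qrise p p (N - j) * qrise p p j * qrise (- (A * p)) p j)
      = qbinom p N j * p ^ ((N - j) choose 2) * qrise (A * p ^ N) p j
            * qrise (- (A * p) * p ^ j) p (N - j) * D" if "j \<le> N" for j
  proof -
    have "qrise p p (N - j) * qrise p p j * qrise (- (A * p)) p j
          * (qbinom p N j * qrise (- (A * p) * p ^ j) p (N - j))
        = (qbinom p ((N - j) + j) j * qrise p p j * qrise p p (N - j))
          * (qrise (- (A * p)) p j * qrise (- (A * p) * p ^ j) p (N - j))"
      using that by (simp only: mult_ac le_add_diff_inverse2)
    also have "\<dots> = qrise p p N * qrise (- (A * p)) p N"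
      unfolding qbinom_mult_qrise qrise_add[symmetric] using that by simp
    finally have "inverse (qrise p p (N - j) * qrise p p j * qrise (- (A * p)) p j)
        = qbinom p N j * qrise (- (A * p) * p ^ j) p (N - j)
          * inverse (qrise p p N * qrise (- (A * p)) p N)"
      by (rule fps_inverse_eqI) (use p in simp)
    then show ?thesis
      unfolding D_def qrise_add by (simp only: mult_ac)
  qed
  have "(\<Sum>j\<le>N. p ^ ((N - j) choose 2) * qrise A p (N + j)
            * inverse (qrise p p (N - j) * qrise p p j * qrise (- (A * p)) p j))
      = (\<Sum>j\<le>N. qbinom p N j * p ^ ((N - j) choose 2) * qrise (A * p ^ N) p j
            * qrise (- (A * p) * p ^ j) p (N - j)) * D"
    unfolding sum_distrib_right by (rule sum.cong[OF refl], rule summand) simp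
  also have "\<dots> = ?R"
    unfolding q_Chu_Vandermonde_minus[OF p(2)] D_def by (simp only: mult_ac)
  finally show ?thesis .
qed

lemma qrise_Suc_nth_0:
  fixes A p :: "'a::comm_ring_1 fps"
  assumes "p $ 0 = 0"
  shows "qrise A p (Suc n) $ 0 = 1 - A $ 0"
  using assms by (induction n) (simp_all add: qrise_Suc)

section \<open>Factoring the summands\<close>

text \<open>
  With \<open>N = r + j\<close>, the exponent of \<open>q\<close> splits into \<open>2 N\<close>, which together with \<open>a^(2 N)\<close> makes
  \<open>(a q)^(2 N)\<close>, and three times an exponent of \<open>p = q^3\<close>. The halving on the left is exact and its
  subtractions do not truncate; writing \<open>r^2\<close> and \<open>j^2\<close> through binomial coefficients makes this
  visible.
\<close>

lemma triple_exponent: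
  fixes n r j :: nat
  shows "3 * n\<^sup>2 + (9 * r\<^sup>2 - 5 * r) div 2 + (3 * j\<^sup>2 - j) + 6 * n * j + 6 * n * r + 6 * r * j
    = 2 * (r + j) + 3 * ((r + j) * (r + j - 1)) + 3 * (r choose 2) + 3 * (2 * (r + j) * n)
      + 3 * n\<^sup>2"
proof -
  define t s where "t = (r choose 2)" and "s = (j choose 2)"
  have r: "r\<^sup>2 = 2 * t + r" and j: "j\<^sup>2 = 2 * s + j"
    by (simp_all add: t_def s_def two_choose_two)
  have "(r + j) * (r + j - 1) + (r + j) = (r + j)\<^sup>2"
    by (cases "r + j") (simp_all add: power2_eq_square)
  also have "\<dots> = 2 * t + 2 * s + 2 * r * j + (r + j)"
    using r j by (simp add: power2_sum)
  finally have N: "(r + j) * (r + j - 1) = 2 * t + 2 * s + 2 * r * j"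
    by simp
  have "9 * r\<^sup>2 - 5 * r = 2 * (9 * t + 2 * r)"
    unfolding r by simp
  then have "(9 * r\<^sup>2 - 5 * r) div 2 = 9 * t + 2 * r"
    by simp
  moreover have "3 * j\<^sup>2 - j = 6 * s + 2 * j"
    unfolding j by simp
  ultimately show ?thesis
    unfolding N t_def[symmetric] by (simp add: algebra_simps)
qed

text \<open>
  Of the indeterminate only the constant term matters. It must be nonzero because of the negative powers
  of \<open>a q\<close>, and its cube must differ from 1 because the denominators contain the factor \<open>1 - a^3\<close>.
\<close>

context
  fixes a q p A x :: "'a::field fps"
  assumes two: "(2::'a) \<noteq> 0"
    and a: "a $ 0 \<noteq> 0" "(a $ 0) ^ 3 \<noteq> 1"
    and q: "q $ 0 = 0" "q \<noteq> 0"
  defines "p \<equiv> q ^ 3" and "A \<equiv> a ^ 3" and "x \<equiv> a * q"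
begin

lemma p_nth_0: "p $ 0 = 0" and p_nz: "p \<noteq> 0"
  using q by (simp_all add: p_def fps_nth_power_0)

lemma qrise_A_nth_0: "qrise A p (Suc n) $ 0 \<noteq> 0"
  using a by (simp add: qrise_Suc_nth_0 p_nth_0 A_def fps_nth_power_0)

text \<open>
  The factor that the summand of the triple sum, for \<open>r + j = N\<close>, shares with the \<open>N\<close>-th summand of the
  single sum. It vanishes to order at least \<open>2 N\<close>, which makes both families summable.
\<close>

definition diagonal_weight :: "nat \<Rightarrow> 'a fps" where
  "diagonal_weight N = x ^ (2 * N) * (1 + x ^ (2 * N)) * (1 - A * p ^ (2 * N)) * p ^ (N * (N - 1))"

definition triple_summand :: "nat \<times> nat \<times> nat \<Rightarrow> 'a fps" where
  "triple_summand = (\<lambda>(n, r, j).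
      a ^ (3*n + 2*r + 2*j)
        * q ^ (3*n^2 + (9*r^2 - 5*r) div 2 + (3*j^2 - j) + 6*n*j + 6*n*r + 6*r*j)
        * qpoch (a^3) (q^3) (int (2*j + r))
        * (1 + (a*q) ^ (2*r + 2*j)) * (1 - a^3 * q ^ (6*j + 6*r))
      / (2 * qpoch (q^3) (q^3) (int n) * qpoch (q^3) (q^3) (int r) * qpoch (q^3) (q^3) (int j)
           * qpoch (- (a^3 * q^3)) (q^3) (int j)
           * qpoch (a^3) (q^3) (int (n + 2*j + 2*r + 1))))"

definition single_summand :: "nat \<Rightarrow> 'a fps" where
  "single_summand = (\<lambda>r.
      a ^ (3*r) * (q ^ (3*r^2) * (a*q) ^ r + q ^ (3*r^2) / (a*q) ^ r)
        * qpoch (a^3) (q^3) (int r) * qpoch (- (q^3)) (q^3) (int r - 1)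
        * (1 - a^3 * q ^ (6*r))
      / (qpoch (q^3) (q^3) (int r) * qpoch (- (a^3 * q^3)) (q^3) (int r) * (1 - a^3)))"

text \<open>
  The first two factors depend on \<open>N = r + j\<close> only, the third on \<open>r\<close> and \<open>j\<close>, and the last one is the
  \<open>n\<close>-th term of the Durfee series for \<open>z = A p^(2 N)\<close>.
\<close>

lemma triple_summand_factor:
  fixes n r j :: nat
  defines "N \<equiv> r + j"
  shows "triple_summand (n, r, j)
    = diagonal_weight N * inverse (2 * qrise A p (Suc (2 * N)))
      * (p ^ (r choose 2) * qrise A p (N + j)
            * inverse (qrise p p r * qrise p p j * qrise (- (A * p)) p j))
      * ((A * p ^ (2 * N)) ^ n * p ^ n\<^sup>2
            * inverse (qrise p p n * qrise (A * p ^ (2 * N) * p) p n))"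
proof -
  have split: "qrise A p (n + 2 * j + 2 * r + 1)
      = qrise A p (Suc (2 * N)) * qrise (A * p ^ (2 * N) * p) p n"
    using qrise_add[of A p "Suc (2 * N)" n] by (simp add: N_def mult_ac add_ac)
  define D where "D = 2 * qrise p p n * qrise p p r * qrise p p j * qrise (- (A * p)) p j
      * (qrise A p (Suc (2 * N)) * qrise (A * p ^ (2 * N) * p) p n)"
  have D0: "D $ 0 \<noteq> 0"
    unfolding D_def using two qrise_A_nth_0 by (simp add: p_nth_0)
  have "x ^ (2 * N) * p ^ (N * (N - 1)) * p ^ (r choose 2) * (A * p ^ (2 * N)) ^ n * p ^ n\<^sup>2
      = a ^ (2 * N + 3 * n) * q ^ (2 * N + 3 * (N * (N - 1)) + 3 * (r choose 2) + 3 * (2 * N * n)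
          + 3 * n\<^sup>2)"
    unfolding x_def p_def A_def power_mult_distrib power_mult[symmetric] mult.assoc[symmetric]
    by (simp only: power_add mult_ac)
  also have "a ^ (2 * N + 3 * n) = a ^ (3 * n + 2 * r + 2 * j)"
    by (simp add: N_def algebra_simps)
  finally have mono: "a ^ (3 * n + 2 * r + 2 * j)
      * q ^ (3*n^2 + (9*r^2 - 5*r) div 2 + (3*j^2 - j) + 6*n*j + 6*n*r + 6*r*j)
      = x ^ (2 * N) * p ^ (N * (N - 1)) * p ^ (r choose 2) * (A * p ^ (2 * N)) ^ n * p ^ n\<^sup>2"
    unfolding triple_exponent N_def by (rule sym)
  have q6: "q ^ (6 * j + 6 * r) = p ^ (2 * N)"
    by (simp add: p_def N_def algebra_simps flip: power_mult)
  have x2: "(a * q) ^ (2 * r + 2 * j) = x ^ (2 * N)"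
    by (simp add: x_def N_def distrib_left)
  have idx: "2 * j + r = N + j"
    by (simp add: N_def)
  have "triple_summand (n, r, j)
      = x ^ (2 * N) * p ^ (N * (N - 1)) * p ^ (r choose 2) * (A * p ^ (2 * N)) ^ n * p ^ n\<^sup>2
        * qrise A p (N + j) * (1 + x ^ (2 * N)) * (1 - A * p ^ (2 * N)) / D"
    unfolding triple_summand_def prod.case mono q6 x2 idx qpoch_int
    unfolding p_def[symmetric] A_def[symmetric] split D_def ..
  also have "\<dots> = x ^ (2 * N) * p ^ (N * (N - 1)) * p ^ (r choose 2) * (A * p ^ (2 * N)) ^ n
        * p ^ n\<^sup>2 * qrise A p (N + j) * (1 + x ^ (2 * N)) * (1 - A * p ^ (2 * N)) * inverse D"
    using D0 by (rule fps_divide_unit)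
  finally show ?thesis
    unfolding D_def diagonal_weight_def fps_inverse_mult by (simp only: mult_ac)
qed

text \<open>
  The left factor 2 is the factor for \<open>i = 0\<close> on the right. At \<open>N = 0\<close>, where the product is empty, it is
  compensated by the value 1/2 of the symbol at index -1.
\<close>

lemma two_qpoch_minus: "2 * qpoch (- p) p (int N - 1) = (\<Prod>i<N. 1 + p ^ i)"
proof (cases N)
  case 0
  have "(- p) / p = - 1"
    using nonzero_mult_div_cancel_left[OF p_nz, of "- 1"] by simp
  then show ?thesis
    using two by (simp add: 0 qpoch_minus_one fps_divide_unit inverse_mult_eq_1')
next
  case (Suc L)
  then have "int N - 1 = int L"
    by simp
  then show ?thesis
    by (simp add: qpoch_int qrise_def Suc prod.lessThan_Suc_shift del: prod.lessThan_Suc)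
qed

text \<open>
  As \<open>x^3 = A p\<close>, the powers \<open>x^N\<close> and \<open>x^(-N)\<close> times \<open>a^(3 N) q^(3 N^2) = x^(3 N) p^(N^2 - N)\<close>
  are \<open>x^(4 N)\<close> and \<open>x^(2 N)\<close> times \<open>p^(N^2 - N)\<close>.
\<close>

lemma single_summand_factor:
  "single_summand N = diagonal_weight N * qrise A p N * qpoch (- p) p (int N - 1)
     * inverse (qrise p p N * qrise (- (A * p)) p N * (1 - A))"
proof -
  define D where "D = qrise p p N * qrise (- (A * p)) p N * (1 - A)"
  have D0: "D $ 0 \<noteq> 0"
    unfolding D_def using a by (simp add: p_nth_0 A_def fps_nth_power_0)
  have "N \<le> 3 * N\<^sup>2"
    using le_square[of N] by (simp add: power2_eq_square)
  then have e: "q ^ (3 * N\<^sup>2) = q ^ N * q ^ (3 * N\<^sup>2 - N)"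
    by (simp add: power_add[symmetric])
  have u: "a ^ N * inverse a ^ N = 1"
    unfolding power_mult_distrib[symmetric] inverse_mult_eq_1'[OF a(1)] by simp
  have "x ^ N * (inverse a ^ N * q ^ (3 * N\<^sup>2 - N))
      = (a ^ N * inverse a ^ N) * (q ^ N * q ^ (3 * N\<^sup>2 - N))"
    unfolding x_def power_mult_distrib by (simp only: mult_ac)
  then have "q ^ (3 * N\<^sup>2) = x ^ N * (inverse a ^ N * q ^ (3 * N\<^sup>2 - N))"
    unfolding u e mult_1_left by (rule sym)
  moreover have "x ^ N \<noteq> 0"
    using a(1) q(2) by (auto simp: x_def)
  ultimately have "q ^ (3 * N\<^sup>2) / x ^ N = inverse a ^ N * q ^ (3 * N\<^sup>2 - N)"
    by (metis nonzero_mult_div_cancel_left)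
  moreover have "a ^ (3 * N) = a ^ N * a ^ (2 * N)"
    by (simp add: power_add[symmetric])
  ultimately have "a ^ (3 * N) * (q ^ (3 * N\<^sup>2) / x ^ N)
      = (a ^ N * inverse a ^ N) * (a ^ (2 * N) * q ^ (3 * N\<^sup>2 - N))"
    by (simp only: mult_ac)
  also have "3 * N\<^sup>2 - N = 2 * N + 3 * (N * (N - 1))"
    by (cases N) (simp_all add: power2_eq_square)
  also have "(a ^ N * inverse a ^ N) * (a ^ (2 * N) * q ^ (2 * N + 3 * (N * (N - 1))))
      = x ^ (2 * N) * p ^ (N * (N - 1))"
    unfolding u x_def p_def power_mult_distrib power_add power_mult[symmetric] by simp
  finally have m1: "a ^ (3 * N) * (q ^ (3 * N\<^sup>2) / x ^ N) = x ^ (2 * N) * p ^ (N * (N - 1))" .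
  have n3: "3 * N\<^sup>2 + N = 4 * N + 3 * (N * (N - 1))"
    by (cases N) (simp_all add: power2_eq_square)
  have "a ^ (4 * N) = a ^ (3 * N) * a ^ N"
    by (simp add: power_add[symmetric])
  then have "a ^ (3 * N) * (q ^ (3 * N\<^sup>2) * x ^ N) = a ^ (4 * N) * q ^ (3 * N\<^sup>2 + N)"
    by (simp add: x_def power_mult_distrib power_add mult_ac)
  also have "\<dots> = x ^ (4 * N) * p ^ (N * (N - 1))"
    unfolding n3 x_def p_def power_mult_distrib power_add[of q] power_mult[symmetric] by simp
  also have "x ^ (4 * N) = x ^ (2 * N) * x ^ (2 * N)"
    by (simp add: power_add[symmetric])
  finally have m2: "a ^ (3 * N) * (q ^ (3 * N\<^sup>2) * x ^ N)
      = x ^ (2 * N) * x ^ (2 * N) * p ^ (N * (N - 1))" .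
  have mono: "a ^ (3 * N) * (q ^ (3 * N\<^sup>2) * x ^ N + q ^ (3 * N\<^sup>2) / x ^ N)
      = x ^ (2 * N) * (1 + x ^ (2 * N)) * p ^ (N * (N - 1))"
    unfolding distrib_left m1 m2 by (simp add: algebra_simps)
  have q6: "q ^ (6 * N) = p ^ (2 * N)"
    by (simp add: p_def flip: power_mult)
  have "single_summand N = x ^ (2 * N) * (1 + x ^ (2 * N)) * p ^ (N * (N - 1)) * qrise A p N
      * qpoch (- p) p (int N - 1) * (1 - A * p ^ (2 * N)) / D"
    unfolding single_summand_def x_def[symmetric] mono q6 qpoch_int
    unfolding p_def[symmetric] A_def[symmetric] D_def ..
  also have "\<dots> = x ^ (2 * N) * (1 + x ^ (2 * N)) * p ^ (N * (N - 1)) * qrise A p N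
      * qpoch (- p) p (int N - 1) * (1 - A * p ^ (2 * N)) * inverse D"
    using D0 by (rule fps_divide_unit)
  finally show ?thesis
    unfolding D_def diagonal_weight_def by (simp only: mult_ac)
qed

lemma fps_X_power_dvd_diagonal_weight: "fps_X ^ (2 * N) dvd diagonal_weight N"
  unfolding diagonal_weight_def by (intro dvd_mult2 fps_X_power_dvd_power) (simp add: x_def q)

lemma single_summand_summable: "single_summand summable_on UNIV"
proof (rule summable_on_fpsI)
  show "fps_X ^ (2 * N) dvd single_summand N" for N
    unfolding single_summand_factor by (intro dvd_mult2 fps_X_power_dvd_diagonal_weight)
  show "finite {N \<in> UNIV. 2 * N \<le> k}" for k :: nat
    by (rule finite_subset[of _ "{..k}"]) auto
qed

lemma triple_summand_summable: "triple_summand summable_on UNIV"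
proof (rule summable_on_fpsI)
  fix t :: "nat \<times> nat \<times> nat"
  obtain n r j where t: "t = (n, r, j)"
    by (cases t)
  have "(fps_X :: 'a fps) ^ (2 * (r + j) + n\<^sup>2) dvd diagonal_weight (r + j) * p ^ n\<^sup>2"
    unfolding power_add
    by (intro mult_dvd_mono fps_X_power_dvd_diagonal_weight fps_X_power_dvd_power p_nth_0)
  also have "\<dots> dvd triple_summand t"
    unfolding t triple_summand_factor
    by (rule mult_dvd_mono, (rule dvd_mult2)+, rule dvd_refl, rule dvd_mult2, rule dvd_triv_right)
  finally show "fps_X ^ (case t of (n, r, j) \<Rightarrow> 2 * (r + j) + n\<^sup>2) dvd triple_summand t"
    by (simp add: t)
next
  fix k :: nat
  have "n \<le> k" if "n\<^sup>2 \<le> k" for n :: nat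
    using le_trans[OF le_square that[unfolded power2_eq_square]] .
  then have "{t \<in> UNIV. (case t of (n, r, j) \<Rightarrow> 2 * (r + j) + n\<^sup>2) \<le> k} \<subseteq> {..k} \<times> {..k} \<times> {..k}"
    by auto
  then show "finite {t \<in> UNIV. (case t of (n, r, j) \<Rightarrow> 2 * (r + j) + n\<^sup>2) \<le> k}"
    by (rule finite_subset) auto
qed

lemma sum_over_first_index:
  "((\<lambda>n. triple_summand (n, r, j)) has_sum
     diagonal_weight (r + j) * inverse (2 * qrise A p (Suc (2 * (r + j))))
      * (p ^ (r choose 2) * qrise A p (r + j + j)
            * inverse (qrise p p r * qrise p p j * qrise (- (A * p)) p j))
      * inverse (qpoch_inf (A * p ^ (2 * (r + j)) * p) p)) UNIV"
  unfolding triple_summand_factor by (intro has_sum_mult_left_fps Durfee_sum p_nth_0)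

text \<open>
  The infinite product left by the sum over \<open>n\<close> still depends on \<open>N\<close>; multiplied by the prefactor
  \<open>qrise A p (2 N + 1)\<close> it becomes \<open>(1 - A) qpoch_inf (A p) p\<close> for every \<open>N\<close>. So the single series
  is matched term by term.
\<close>

lemma diagonal_sum_eq_single_summand:
  "(\<Sum>j\<le>N. diagonal_weight N * inverse (2 * qrise A p (Suc (2 * N)))
      * (p ^ ((N - j) choose 2) * qrise A p (N + j)
            * inverse (qrise p p (N - j) * qrise p p j * qrise (- (A * p)) p j))
      * inverse (qpoch_inf (A * p ^ (2 * N) * p) p))
    = inverse (qpoch_inf (A * p) p) * single_summand N"
proof -
  have "(\<Sum>j\<le>N. diagonal_weight N * inverse (2 * qrise A p (Suc (2 * N)))
      * (p ^ ((N - j) choose 2) * qrise A p (N + j)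
            * inverse (qrise p p (N - j) * qrise p p j * qrise (- (A * p)) p j))
      * inverse (qpoch_inf (A * p ^ (2 * N) * p) p))
    = diagonal_weight N * inverse (2 * qrise A p (Suc (2 * N)))
      * (qrise A p N * (\<Prod>i<N. 1 + p ^ i) * inverse (qrise p p N * qrise (- (A * p)) p N))
      * inverse (qpoch_inf (A * p ^ (2 * N) * p) p)"
    unfolding sum_over_antidiagonal[OF p_nth_0 p_nz, symmetric]
    by (simp only: sum_distrib_left sum_distrib_right)
  also have "\<dots> = (2 * inverse 2) * (diagonal_weight N * qrise A p N * qpoch (- p) p (int N - 1)
      * inverse (qrise p p N * qrise (- (A * p)) p N)
      * inverse (qrise A p (Suc (2 * N)) * qpoch_inf (A * p ^ (2 * N) * p) p))"
    unfolding two_qpoch_minus[symmetric] fps_inverse_mult by (simp only: mult_ac)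
  also have "2 * inverse 2 = (1 :: 'a fps)"
    using two by (intro inverse_mult_eq_1') simp
  also have "1 * (diagonal_weight N * qrise A p N * qpoch (- p) p (int N - 1)
      * inverse (qrise p p N * qrise (- (A * p)) p N)
      * inverse (qrise A p (Suc (2 * N)) * qpoch_inf (A * p ^ (2 * N) * p) p))
    = inverse (qpoch_inf (A * p) p) * single_summand N"
    unfolding qpoch_inf_split[OF p_nth_0] single_summand_factor fps_inverse_mult
    by (simp only: mult_ac mult_1_left)
  finally show ?thesis .
qed

text \<open>
  The summation order is \<open>n\<close> first, then the antidiagonals \<open>r + j = N\<close>, then \<open>N\<close>; the index \<open>((N, j), n)\<close>
  reflects this nesting.
\<close>

lemma triple_summand_has_sum:
  "(triple_summand has_sum inverse (qpoch_inf (A * p) p) * infsum single_summand UNIV) UNIV"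
proof -
  define I where "I = (SIGMA N:UNIV. {..N::nat})"
  define f where "f = (\<lambda>((N, j), n). triple_summand (n, N - j, j))"
  define g where "g = (\<lambda>(N, j). diagonal_weight N * inverse (2 * qrise A p (Suc (2 * N)))
      * (p ^ ((N - j) choose 2) * qrise A p (N + j)
            * inverse (qrise p p (N - j) * qrise p p j * qrise (- (A * p)) p j))
      * inverse (qpoch_inf (A * p ^ (2 * N) * p) p))"
  have total: "(triple_summand has_sum infsum triple_summand UNIV) UNIV"
    using triple_summand_summable by (rule has_sum_infsum)
  also have "?this \<longleftrightarrow> (f has_sum infsum triple_summand UNIV) (I \<times> UNIV)"
    by (rule has_sum_reindex_bij_witness[where j = "\<lambda>(n, r, j). ((r + j, j), n)"
          and i = "\<lambda>((N, j), n). (n, N - j, j)"])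
       (auto simp: I_def f_def)
  finally have "(g has_sum infsum triple_summand UNIV) I"
  proof (rule has_sum_Sigma[OF uniformly_continuous_add_fps])
    fix Nj assume "Nj \<in> I"
    then obtain N j where Nj: "Nj = (N, j)" "j \<le> N"
      by (auto simp: I_def)
    then show "((\<lambda>n. f (Nj, n)) has_sum g Nj) UNIV"
      using sum_over_first_index[of "N - j" j] by (simp add: f_def g_def)
  qed
  then have "((\<lambda>N. \<Sum>j\<le>N. g (N, j)) has_sum infsum triple_summand UNIV) UNIV"
    unfolding I_def
    by (rule has_sum_Sigma[OF uniformly_continuous_add_fps]) (rule has_sum_finite, simp)
  moreover have "(\<lambda>N. \<Sum>j\<le>N. g (N, j)) = (\<lambda>N. inverse (qpoch_inf (A * p) p) * single_summand N)"
    unfolding g_def prod.case diagonal_sum_eq_single_summand ..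
  ultimately have "((\<lambda>N. inverse (qpoch_inf (A * p) p) * single_summand N)
      has_sum infsum triple_summand UNIV) UNIV"
    by (rule back_subst[where P = "\<lambda>f. (f has_sum infsum triple_summand UNIV) UNIV"])
  then have "infsum triple_summand UNIV
      = infsum (\<lambda>N. inverse (qpoch_inf (A * p) p) * single_summand N) UNIV"
    by (rule infsumI[symmetric])
  also have "\<dots> = inverse (qpoch_inf (A * p) p) * infsum single_summand UNIV"
    by (intro infsumI has_sum_mult_left_fps has_sum_infsum single_summand_summable)
  finally show ?thesis
    using total by (rule subst)
qed

end

section \<open>The identity\<close>

theorem theorem3p3:
  fixes a q :: "'k::field_char_0 poly fract fps"
    and lhs_term :: "nat \<times> nat \<times> nat \<Rightarrow> 'k poly fract fps"
    and rhs_term :: "nat \<Rightarrow> 'k poly fract fps"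
  defines "a \<equiv> indet" and "q \<equiv> fps_X"
  defines "lhs_term \<equiv> (\<lambda>(n, r, j).
      a ^ (3*n + 2*r + 2*j)
        * q ^ (3*n^2 + (9*r^2 - 5*r) div 2 + (3*j^2 - j) + 6*n*j + 6*n*r + 6*r*j)
        * qpoch (a^3) (q^3) (int (2*j + r))
        * (1 + (a*q) ^ (2*r + 2*j)) * (1 - a^3 * q ^ (6*j + 6*r))
      / (2 * qpoch (q^3) (q^3) (int n) * qpoch (q^3) (q^3) (int r) * qpoch (q^3) (q^3) (int j)
           * qpoch (- (a^3 * q^3)) (q^3) (int j)
           * qpoch (a^3) (q^3) (int (n + 2*j + 2*r + 1))))"
    and "rhs_term \<equiv> (\<lambda>r.
      a ^ (3*r) * (q ^ (3*r^2) * (a*q) ^ r + q ^ (3*r^2) / (a*q) ^ r)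
        * qpoch (a^3) (q^3) (int r) * qpoch (- (q^3)) (q^3) (int r - 1)
        * (1 - a^3 * q ^ (6*r))
      / (qpoch (q^3) (q^3) (int r) * qpoch (- (a^3 * q^3)) (q^3) (int r) * (1 - a^3)))"
  shows "lhs_term summable_on UNIV \<and> rhs_term summable_on UNIV \<and>
         convergent_prod (\<lambda>i. 1 - (a^3 * q^3) * (q^3) ^ i) \<and>
         (\<Sum>\<^sub>\<infinity>nrj\<in>UNIV. lhs_term nrj)
           = 1 / qpoch_inf (a^3 * q^3) (q^3) * (\<Sum>\<^sub>\<infinity>r\<in>UNIV. rhs_term r)"
proof -
  have a0: "fps_nth a 0 = Fract [:0, 1:] 1"
    by (simp add: a_def indet_def)
  have two: "(2 :: 'k poly fract) \<noteq> 0"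
  proof -
    have "(2 :: 'k poly fract) = Fract 1 1 + Fract 1 1"
      by (simp flip: One_fract_def)
    also have "\<dots> = Fract 2 1"
      by simp
    finally have e: "(2 :: 'k poly fract) = Fract 2 1" .
    show ?thesis
      unfolding e Zero_fract_def by (simp add: eq_fract)
  qed
  have nz: "fps_nth a 0 \<noteq> 0"
    unfolding a0 by (simp add: Zero_fract_def eq_fract)
  have cube: "fps_nth a 0 ^ 3 \<noteq> 1"
    unfolding a0 by (simp add: One_fract_def eq_fract power3_eq_cube one_pCons)
  have q: "fps_nth q 0 = 0" "q \<noteq> 0"
    by (simp_all add: q_def)
  have lhs: "lhs_term = triple_summand a q"
    by (simp only: lhs_term_def triple_summand_def[OF two nz cube q])
  have rhs: "rhs_term = single_summand a q"
    by (simp only: rhs_term_def single_summand_def[OF two nz cube q])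
  have unit: "fps_nth (qpoch_inf (a ^ 3 * q ^ 3) (q ^ 3)) 0 = 1"
    and conv: "convergent_prod (\<lambda>i. 1 - (a ^ 3 * q ^ 3) * (q ^ 3) ^ i)"
    using q by (simp_all add: qrise_tendsto_qpoch_inf fps_nth_power_0)
  have "infsum lhs_term UNIV = inverse (qpoch_inf (a ^ 3 * q ^ 3) (q ^ 3)) * infsum rhs_term UNIV"
    unfolding lhs rhs by (rule infsumI[OF triple_summand_has_sum[OF two nz cube q]])
  also have "inverse (qpoch_inf (a ^ 3 * q ^ 3) (q ^ 3)) = 1 / qpoch_inf (a ^ 3 * q ^ 3) (q ^ 3)"
    using unit by (simp add: fps_divide_unit)
  finally show ?thesis
    using triple_summand_summable[OF two nz cube q] single_summand_summable[OF two nz cube q] conv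
    unfolding lhs rhs by blast
qed

end
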